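(* Let $\mathcal{H}_1,\mathcal{H},\mathcal{H}_2$ be separable Hilbert spaces and let $(\zeta_k)_{k\in K}\subseteq\mathcal{H}_1$, $(\psi_k)_{k\in K},(\phi_k)_{k\in K}\subseteq\mathcal{H}$ and $(\xi_k)_{k\in K}\subseteq\mathcal{H}_2$ be Bessel sequences such that $(\phi_k)$ and $(\psi_k)$ are biorthogonal to each other. Then for all $m^{(1)},m^{(2)}\in l^\infty(K)$, $$\mathbf{M}_{m^{(1)},(\xi_k),(\psi_k)}\circ\mathbf{M}_{m^{(2)},(\phi_k),(\zeta_k)}=\mathbf{M}_{m^{(1)}\cdot m^{(2)},(\xi_k),(\zeta_k)},$$ where $m^{(1)}\cdot m^{(2)}$ is the pointwise product.
   Context: $K$ is a countable index set. Inner products are linear in the first argument. A sequence $(\psi_k)_{k\in K}$ in a Hilbert space is a Bessel sequence if there is $B>0$ with $\sum_k|\langle f,\psi_k\rangle|^2\le B\|f\|^2$ for all $f$. Two sequences are biorthogonal if $\langle\phi_k,\psi_l\rangle=\delta_{k,l}$ for all $k,l\in K$. For Bessel sequences $(\beta_k)$ in $\mathcal{G}_1$ and $(\alpha_k)$ in $\mathcal{G}_2$ and $m\in l^\infty(K)$, the Bessel multiplier $\mathbf{M}_{m,(\alpha_k),(\beta_k)}:\mathcal{G}_1\to\mathcal{G}_2$ is $f\mapsto\sum_k m_k\langle f,\beta_k\rangle\alpha_k$. *)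

theory Defs
  imports "HOL-Analysis.Analysis"
begin

text \<open>
  The distribution only has real inner product spaces. The classes below add complex scalars to
  \<^class>\<open>real_normed_vector\<close>. The inner product is linear in its first argument.
\<close>

class complex_inner = real_normed_vector +
  fixes scaleC :: "complex \<Rightarrow> 'a \<Rightarrow> 'a" (infixr "*\<^sub>C" 75)
    and cinner :: "'a \<Rightarrow> 'a \<Rightarrow> complex"
  assumes scaleC_add_right: "a *\<^sub>C (x + y) = a *\<^sub>C x + a *\<^sub>C y"
    and scaleC_add_left: "(a + b) *\<^sub>C x = a *\<^sub>C x + b *\<^sub>C x"
    and scaleC_scaleC: "a *\<^sub>C (b *\<^sub>C x) = (a * b) *\<^sub>C x"
    and scaleC_one: "1 *\<^sub>C x = x"
    and scaleR_scaleC: "r *\<^sub>R x = complex_of_real r *\<^sub>C x"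
    and cinner_commute: "cinner x y = cnj (cinner y x)"
    and cinner_add_left: "cinner (x + y) z = cinner x z + cinner y z"
    and cinner_scaleC_left: "cinner (a *\<^sub>C x) y = a * cinner x y"
    and cinner_ge_zero: "0 \<le> Re (cinner x x)"
    and cinner_eq_zero_iff: "cinner x x = 0 \<longleftrightarrow> x = 0"
    and norm_eq_sqrt_cinner: "norm x = sqrt (Re (cinner x x))"

class complex_hilbert_space = complex_inner + complete_space

instantiation complex :: complex_hilbert_space
begin

definition scaleC_complex :: "complex \<Rightarrow> complex \<Rightarrow> complex" where
  "scaleC_complex a x = a * x"

definition cinner_complex :: "complex \<Rightarrow> complex \<Rightarrow> complex" where
  "cinner_complex x y = x * cnj y"

instance
  by standard
    (auto simp: scaleC_complex_def cinner_complex_def algebra_simps scaleR_conv_of_real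
       cmod_def power2_eq_square)

end

text \<open>
  Families are total functions on the index type; only their values on \<open>K\<close> matter. Sums over \<open>K\<close>
  are unordered (unconditional) norm-convergent sums. Since \<^const>\<open>infsum\<close> is \<open>0\<close> for divergent
  families, convergence is demanded explicitly in the Bessel condition.
\<close>

definition Bessel_seq :: "'k set \<Rightarrow> ('k \<Rightarrow> 'a::complex_inner) \<Rightarrow> bool" where
  "Bessel_seq K \<psi> \<longleftrightarrow>
     (\<exists>B>0. \<forall>f. (\<lambda>k. (cmod (cinner f (\<psi> k)))\<^sup>2) summable_on K \<and>
                (\<Sum>\<^sub>\<infinity>k\<in>K. (cmod (cinner f (\<psi> k)))\<^sup>2) \<le> B * (norm f)\<^sup>2)"

definition biorthogonal ::
    "'k set \<Rightarrow> ('k \<Rightarrow> 'a::complex_inner) \<Rightarrow> ('k \<Rightarrow> 'a) \<Rightarrow> bool" where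
  "biorthogonal K \<phi> \<psi> \<longleftrightarrow>
     (\<forall>k\<in>K. \<forall>l\<in>K. cinner (\<phi> k) (\<psi> l) = (if k = l then 1 else 0))"

definition l_infinity :: "'k set \<Rightarrow> ('k \<Rightarrow> complex) set" where
  "l_infinity K = {m. bounded (m ` K)}"

text \<open>
  The defining series converges unconditionally for every \<open>f\<close> when \<open>\<alpha>\<close> and \<open>\<beta>\<close> are Bessel
  sequences in Hilbert spaces and \<open>m\<close> is bounded on \<open>K\<close>; the definition is only meant to be
  used in that case.
\<close>

definition Bessel_multiplier ::
    "'k set \<Rightarrow> ('k \<Rightarrow> complex) \<Rightarrow> ('k \<Rightarrow> 'b::complex_hilbert_space) \<Rightarrow>
     ('k \<Rightarrow> 'a::complex_hilbert_space) \<Rightarrow> 'a \<Rightarrow> 'b" where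
  "Bessel_multiplier K m \<alpha> \<beta> = (\<lambda>f. \<Sum>\<^sub>\<infinity>k\<in>K. (m k * cinner f (\<beta> k)) *\<^sub>C \<alpha> k)"

end

theory Submission
  imports Defs
begin

text \<open>
  For square-summable \<open>c\<close> and a Bessel sequence \<open>\<phi>\<close> with bound \<open>B\<close>, duality gives
  \<open>\<parallel>\<Sum>k\<in>F. c\<^sub>k \<phi>\<^sub>k\<parallel>\<^sup>2 \<le> B (\<Sum>k\<in>F. |c\<^sub>k|\<^sup>2)\<close> on finite \<open>F\<close>, so the series over \<open>K\<close> converges
  unconditionally. With \<open>c\<^sub>k = m\<^sub>k \<langle>f, \<zeta>\<^sub>k\<rangle>\<close> the inner multiplier therefore yields an honest sum, and
  continuity of the inner product and biorthogonality show that its coefficient against \<open>\<psi>\<^sub>l\<close> is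
  exactly \<open>c\<^sub>l\<close>; the two sides then agree term by term.
\<close>

lemma complex_inner_scaleC_zero_left: "0 *\<^sub>C x = (0 :: 'a::complex_inner)"
  using scaleR_scaleC[of 0 x] by simp

lemma cinner_add_right: "cinner x (y + z) = cinner x y + cinner x (z :: 'a::complex_inner)"
  by (metis cinner_add_left cinner_commute complex_cnj_add)

lemma cinner_scaleC_right: "cinner x (a *\<^sub>C y) = cnj a * cinner x (y :: 'a::complex_inner)"
  by (metis cinner_scaleC_left cinner_commute complex_cnj_mult)

lemma cinner_zero_left: "cinner 0 (y :: 'a::complex_inner) = 0"
  using cinner_scaleC_left[of 0 0 y] by (simp add: complex_inner_scaleC_zero_left)

lemma cinner_sum_left: "cinner (sum f F) (y :: 'a::complex_inner) = (\<Sum>k\<in>F. cinner (f k) y)"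
  by (induction F rule: infinite_finite_induct) (simp_all add: cinner_zero_left cinner_add_left)

lemma cinner_self_eq_norm: "cinner x (x :: 'a::complex_inner) = complex_of_real ((norm x)\<^sup>2)"
proof (rule complex_eqI)
  show "Re (cinner x x) = Re (complex_of_real ((norm x)\<^sup>2))"
    by (simp add: norm_eq_sqrt_cinner cinner_ge_zero)
  show "Im (cinner x x) = Im (complex_of_real ((norm x)\<^sup>2))"
    using arg_cong[OF cinner_commute[of x x], of Im] by simp
qed

lemma norm_scaleC: "norm (a *\<^sub>C x) = cmod a * norm (x :: 'a::complex_inner)"
proof -
  have "cinner (a *\<^sub>C x) (a *\<^sub>C x) = a * cnj a * cinner x x"
    by (simp add: cinner_scaleC_left cinner_scaleC_right)
  also have "\<dots> = complex_of_real ((cmod a * norm x)\<^sup>2)"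
    by (simp add: cinner_self_eq_norm complex_norm_square[symmetric] power_mult_distrib)
  finally have "(norm (a *\<^sub>C x))\<^sup>2 = (cmod a * norm x)\<^sup>2"
    unfolding cinner_self_eq_norm of_real_eq_iff .
  then show ?thesis
    by simp
qed

lemma cmod_cinner_commute: "cmod (cinner x y) = cmod (cinner y (x :: 'a::complex_inner))"
  by (metis cinner_commute complex_mod_cnj)

lemma Re_cinner_le_norm: "Re (cinner x y) \<le> norm x * norm (y :: 'a::complex_inner)"
proof -
  have "(norm (x + y))\<^sup>2 = Re (cinner (x + y) (x + y))"
    by (simp add: cinner_self_eq_norm)
  also have "\<dots> = Re (cinner x x) + Re (cinner y y) + 2 * Re (cinner x y)"
    using cinner_commute[of y x] by (simp add: cinner_add_left cinner_add_right)
  also have "\<dots> = (norm x)\<^sup>2 + (norm y)\<^sup>2 + 2 * Re (cinner x y)"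
    by (simp add: cinner_self_eq_norm)
  finally have "(norm x)\<^sup>2 + (norm y)\<^sup>2 + 2 * Re (cinner x y) \<le> (norm x + norm y)\<^sup>2"
    using power_mono[OF norm_triangle_ineq[of x y], of 2] by simp
  then show ?thesis
    by (simp add: power2_sum)
qed

lemma cmod_cinner_le_norm: "cmod (cinner x y) \<le> norm x * norm (y :: 'a::complex_inner)"
proof (cases "cinner x y = 0")
  case False
  define a where "a = cnj (sgn (cinner x y))"
  have "cmod a = 1"
    using False by (simp add: a_def norm_sgn)
  have "a * cinner x y = complex_of_real (cmod (cinner x y))"
    using False
    by (simp add: a_def sgn_eq mult.commute complex_norm_square[symmetric] power2_eq_square)
  then have "cmod (cinner x y) = Re (cinner (a *\<^sub>C x) y)"
    by (simp add: cinner_scaleC_left)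
  also have "\<dots> \<le> norm x * norm y"
    using Re_cinner_le_norm[of "a *\<^sub>C x" y] \<open>cmod a = 1\<close> by (simp add: norm_scaleC)
  finally show ?thesis .
qed simp

lemma bounded_linear_cinner_left: "bounded_linear (\<lambda>x. cinner x (y :: 'a::complex_inner))"
proof (rule bounded_linear_intro[where K = "norm y"])
  show "cinner (r *\<^sub>R x) y = r *\<^sub>R cinner x y" for r x
    unfolding scaleR_scaleC[of r x] cinner_scaleC_left by (rule scaleR_conv_of_real[symmetric])
qed (rule cinner_add_left cmod_cinner_le_norm)+

lemma summable_on_if_norm_sum_sq_le:
  fixes f :: "'k \<Rightarrow> 'a::{real_normed_vector, complete_space}" and g :: "'k \<Rightarrow> real"
  assumes "g summable_on A" and "C > 0"
    and bound: "\<And>F. finite F \<Longrightarrow> F \<subseteq> A \<Longrightarrow> (norm (sum f F))\<^sup>2 \<le> C * sum g F"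
  shows "f summable_on A"
proof -
  from assms(1) obtain S where lim: "(sum g \<longlongrightarrow> S) (finite_subsets_at_top A)"
    unfolding summable_on_def has_sum_def by blast
  have "\<exists>P. eventually P (finite_subsets_at_top A) \<and>
          (\<forall>F F'. P F \<and> P F' \<longrightarrow> dist (sum f F) (sum f F') < e)" if "e > 0" for e
  proof -
    define d where "d = (e / 2)\<^sup>2 / (2 * C)"
    have "d > 0"
      using \<open>e > 0\<close> \<open>C > 0\<close> by (simp add: d_def)
    with lim have "\<forall>\<^sub>F F in finite_subsets_at_top A. dist (sum g F) S < d"
      by (rule tendstoD)
    then obtain F0 where F0: "finite F0" "F0 \<subseteq> A"
      and near: "\<forall>F. finite F \<and> F0 \<subseteq> F \<and> F \<subseteq> A \<longrightarrow> dist (sum g F) S < d"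
      by (auto simp: eventually_finite_subsets_at_top)
    define P where "P F \<longleftrightarrow> finite F \<and> F0 \<subseteq> F \<and> F \<subseteq> A" for F
    have "eventually P (finite_subsets_at_top A)"
      unfolding eventually_finite_subsets_at_top P_def using F0 by blast
    moreover have close: "dist (sum f F) (sum f F0) < e / 2" if "P F" for F
    proof -
      have F: "finite F" "F0 \<subseteq> F" "F \<subseteq> A"
        using that by (auto simp: P_def)
      have "(dist (sum f F) (sum f F0))\<^sup>2 = (norm (sum f (F - F0)))\<^sup>2"
        using F by (simp add: dist_norm sum_diff)
      also have "\<dots> \<le> C * sum g (F - F0)"
        using F by (intro bound) auto
      also have "\<dots> = C * (sum g F - sum g F0)"
        using F by (simp add: sum_diff)
      also have "\<dots> < C * (2 * d)"
        using near[rule_format, of F] near[rule_format, of F0] F F0 \<open>C > 0\<close>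
        by (intro mult_strict_left_mono) (auto simp: dist_real_def)
      also have "\<dots> = (e / 2)\<^sup>2"
        using \<open>C > 0\<close> by (simp add: d_def)
      finally show ?thesis
        by (rule power_less_imp_less_base) (use \<open>e > 0\<close> in simp)
    qed
    have "dist (sum f F) (sum f F') < e" if "P F" "P F'" for F F'
      using close[OF that(1)] close[OF that(2)] dist_triangle2[of "sum f F" "sum f F'" "sum f F0"]
      by linarith
    ultimately show ?thesis
      by blast
  qed
  then have "cauchy_filter (filtermap (sum f) (finite_subsets_at_top A))"
    by (simp add: cauchy_filter_metric_filtermap)
  moreover have "complete (UNIV :: 'a set)"
    by (meson Cauchy_convergent UNIV_I complete_def convergent_def)
  ultimately obtain L where "(sum f \<longlongrightarrow> L) (finite_subsets_at_top A)"
    using complete_uniform[where S = UNIV] by (force simp: filterlim_def)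
  then show ?thesis
    using summable_on_def has_sum_def by blast
qed

lemma Bessel_seq_synthesis_summable:
  fixes \<phi> :: "'k \<Rightarrow> 'a::complex_hilbert_space"
  assumes "Bessel_seq K \<phi>" and "(\<lambda>k. (cmod (c k))\<^sup>2) summable_on K"
  shows "(\<lambda>k. c k *\<^sub>C \<phi> k) summable_on K"
proof -
  from assms(1) obtain B where "B > 0"
    and summ: "\<And>f. (\<lambda>k. (cmod (cinner f (\<phi> k)))\<^sup>2) summable_on K"
    and B: "\<And>f. (\<Sum>\<^sub>\<infinity>k\<in>K. (cmod (cinner f (\<phi> k)))\<^sup>2) \<le> B * (norm f)\<^sup>2"
    unfolding Bessel_seq_def by blast
  show ?thesis
  proof (rule summable_on_if_norm_sum_sq_le[OF assms(2) \<open>B > 0\<close>])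
    fix F assume F: "finite F" "F \<subseteq> K"
    define v where "v = (\<Sum>k\<in>F. c k *\<^sub>C \<phi> k)"
    define s where "s = (\<Sum>k\<in>F. (cmod (c k))\<^sup>2)"
    have "(\<Sum>k\<in>F. (cmod (cinner v (\<phi> k)))\<^sup>2) \<le> B * (norm v)\<^sup>2"
      using finite_sum_le_infsum[OF summ F] B by (meson order_trans zero_le_power2)
    moreover have "s \<ge> 0"
      unfolding s_def by (simp add: sum_nonneg)
    moreover have "(norm v)\<^sup>2 \<le> (\<Sum>k\<in>F. \<bar>cmod (c k)\<bar> * \<bar>cmod (cinner v (\<phi> k))\<bar>)"
    proof -
      have "cinner v v = (\<Sum>k\<in>F. c k * cinner (\<phi> k) v)"
        by (subst (1) v_def) (simp add: cinner_sum_left cinner_scaleC_left)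
      then have "(norm v)\<^sup>2 = cmod (\<Sum>k\<in>F. c k * cinner (\<phi> k) v)"
        by (metis cinner_self_eq_norm norm_of_real abs_power2)
      also have "\<dots> \<le> (\<Sum>k\<in>F. cmod (c k * cinner (\<phi> k) v))"
        by (rule norm_sum)
      also have "\<dots> = (\<Sum>k\<in>F. \<bar>cmod (c k)\<bar> * \<bar>cmod (cinner v (\<phi> k))\<bar>)"
        by (simp add: norm_mult cmod_cinner_commute[of v])
      finally show ?thesis .
    qed
    then have "(norm v)\<^sup>2 \<le> sqrt s * sqrt (\<Sum>k\<in>F. (cmod (cinner v (\<phi> k)))\<^sup>2)"
      using L2_set_mult_ineq[of "\<lambda>k. cmod (c k)" "\<lambda>k. cmod (cinner v (\<phi> k))" F]
      by (simp add: L2_set_def s_def)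
    ultimately have "(norm v)\<^sup>2 \<le> sqrt s * sqrt (B * (norm v)\<^sup>2)"
      by (meson mult_left_mono order_trans real_sqrt_ge_zero real_sqrt_le_mono)
    then have "norm v * norm v \<le> sqrt (B * s) * norm v"
      by (simp add: real_sqrt_mult power2_eq_square mult_ac)
    then have "norm v \<le> sqrt (B * s)"
      using \<open>s \<ge> 0\<close> \<open>B > 0\<close> by (cases "norm v = 0") (auto simp: mult_le_cancel_right)
    then show "(norm (\<Sum>k\<in>F. c k *\<^sub>C \<phi> k))\<^sup>2 \<le> B * (\<Sum>k\<in>F. (cmod (c k))\<^sup>2)"
      using \<open>s \<ge> 0\<close> \<open>B > 0\<close> power_mono[of "norm v" "sqrt (B * s)" 2] by (simp add: v_def s_def)
  qed
qed

lemma l_infinity_mult_square_summable: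
  assumes "m \<in> l_infinity K" and "(\<lambda>k. (cmod (c k))\<^sup>2) summable_on K"
  shows "(\<lambda>k. (cmod (m k * c k))\<^sup>2) summable_on K"
proof -
  from assms(1) obtain b where b: "\<And>k. k \<in> K \<Longrightarrow> cmod (m k) \<le> b"
    unfolding l_infinity_def bounded_iff by blast
  show ?thesis
  proof (rule summable_on_comparison_test)
    show "(\<lambda>k. b\<^sup>2 * (cmod (c k))\<^sup>2) summable_on K"
      by (rule summable_on_cmult_right[OF assms(2)])
    show "(cmod (m k * c k))\<^sup>2 \<le> b\<^sup>2 * (cmod (c k))\<^sup>2" if "k \<in> K" for k
      using power_mono[OF b[OF that], of 2]
      by (simp add: norm_mult power_mult_distrib mult_right_mono)
  qed simp
qed

lemma cinner_Bessel_multiplier_biorthogonal: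
  assumes "Bessel_seq K \<zeta>" and "Bessel_seq K \<phi>" and "biorthogonal K \<phi> \<psi>"
    and "m \<in> l_infinity K" and "l \<in> K"
  shows "cinner (Bessel_multiplier K m \<phi> \<zeta> f) (\<psi> l) = m l * cinner f (\<zeta> l)"
proof -
  define c where "c k = m k * cinner f (\<zeta> k)" for k
  have "(\<lambda>k. (cmod (cinner f (\<zeta> k)))\<^sup>2) summable_on K"
    using assms(1) unfolding Bessel_seq_def by blast
  then have "(\<lambda>k. c k *\<^sub>C \<phi> k) summable_on K"
    unfolding c_def using assms
    by (intro Bessel_seq_synthesis_summable l_infinity_mult_square_summable)
  then have "((\<lambda>k. cinner (c k *\<^sub>C \<phi> k) (\<psi> l)) has_sum
      cinner (Bessel_multiplier K m \<phi> \<zeta> f) (\<psi> l)) K"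
    unfolding Bessel_multiplier_def c_def[symmetric]
    by (intro has_sum_bounded_linear[OF bounded_linear_cinner_left]) simp
  moreover have "((\<lambda>k. cinner (c k *\<^sub>C \<phi> k) (\<psi> l)) has_sum c l) K \<longleftrightarrow>
      ((\<lambda>k. c l) has_sum c l) {l}"
    using assms(3,5) by (intro has_sum_cong_neutral)
      (auto simp: biorthogonal_def cinner_scaleC_left)
  then have "((\<lambda>k. cinner (c k *\<^sub>C \<phi> k) (\<psi> l)) has_sum c l) K"
    using has_sum_finite[of "{l}" "\<lambda>k. c l"] by simp
  ultimately show ?thesis
    unfolding c_def using has_sum_unique by blast
qed

theorem corollary7p3:
  fixes K :: "'k set"
    and \<zeta> :: "'k \<Rightarrow> 'h1::complex_hilbert_space"
    and \<psi> \<phi> :: "'k \<Rightarrow> 'h::complex_hilbert_space"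
    and \<xi> :: "'k \<Rightarrow> 'h2::complex_hilbert_space"
    and m1 m2 :: "'k \<Rightarrow> complex"
  assumes "countable K"
    and "separable_space (euclidean :: 'h1 topology)"
    and "separable_space (euclidean :: 'h topology)"
    and "separable_space (euclidean :: 'h2 topology)"
    and "Bessel_seq K \<zeta>" and "Bessel_seq K \<psi>" and "Bessel_seq K \<phi>" and "Bessel_seq K \<xi>"
    and "biorthogonal K \<phi> \<psi>"
    and "m1 \<in> l_infinity K" and "m2 \<in> l_infinity K"
  shows "Bessel_multiplier K m1 \<xi> \<psi> \<circ> Bessel_multiplier K m2 \<phi> \<zeta>
       = Bessel_multiplier K (\<lambda>k. m1 k * m2 k) \<xi> \<zeta>"
proof
  fix f
  have "Bessel_multiplier K m1 \<xi> \<psi> (Bessel_multiplier K m2 \<phi> \<zeta> f) =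
      Bessel_multiplier K (\<lambda>k. m1 k * m2 k) \<xi> \<zeta> f"
    unfolding Bessel_multiplier_def[of K m1] Bessel_multiplier_def[of K "\<lambda>k. m1 k * m2 k"]
    by (intro infsum_cong)
      (simp add: cinner_Bessel_multiplier_biorthogonal[OF assms(5,7,9,11)] mult.assoc)
  then show "(Bessel_multiplier K m1 \<xi> \<psi> \<circ> Bessel_multiplier K m2 \<phi> \<zeta>) f =
      Bessel_multiplier K (\<lambda>k. m1 k * m2 k) \<xi> \<zeta> f"
    by simp
qed

end
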